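(* The optimum dimension of the Weisfeiler-Lehman algorithm on graphs of order $n$ satisfies $\mathrm{WL}(n)\le (n+1)/2$.
   Context: Graphs are finite, undirected and loopless; the order $|G|$ of a graph $G$ is its number of vertices. Let $k\ge1$. Two tuples $\bar u\in V(G)^k$ and $\bar v\in V(G')^k$ have the same isomorphism type, $[\bar u]=[\bar v]$, if for all $i,j$: $u_i=u_j$ iff $v_i=v_j$, and $u_i,u_j$ are adjacent in $G$ iff $v_i,v_j$ are adjacent in $G'$. For $w\in V(G)$ and $i\le k$, $\bar u^{i,w}$ denotes the result of substituting $w$ in place of $u_i$ in $\bar u$. The $k$-dimensional Weisfeiler-Lehman algorithm (in a relaxed version, where a set is used in the refinement step; the standard algorithm uses a multiset there) colors $k$-tuples of vertices as follows. Initial coloring: $W_G^{k,0}(\bar u)=[\bar u]$. Refinement step, $r\ge1$: $$W_G^{k,r}(\bar u)=\Bigl(W_G^{k,r-1}(\bar u),\ \bigl\{\bigl(W_G^{k,r-1}(\bar u^{1,w}),\ldots,W_G^{k,r-1}(\bar u^{k,w})\bigr): w\in V(G)\bigr\}\Bigr).$$ In the isomorphism testing mode, on input $G,G'$ (with disjoint vertex sets), let $\Pi^r$ be the partition of $V(G)^k\cup V(G')^k$ into classes of tuples with equal colors under $W_G^{k,r}$ and $W_{G'}^{k,r}$. The algorithm stops refinement as soon as $\Pi^r=\Pi^{r-1}$ and decides that $G\cong G'$ iff $$\{W_G^{k,r}(u,\ldots,u):u\in V(G)\}=\{W_{G'}^{k,r}(v,\ldots,v):v\in V(G')\}.$$ For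 graphs $G,G'$ of order $n$, the optimum dimension $\mathrm{WL}(G,G')$ is the smallest dimension $k$ for which the algorithm gives the right output on $G,G'$ in the isomorphism testing mode, and $\mathrm{WL}(n)=\max\{\mathrm{WL}(G,G') : G'\not\cong G,\ |G'|=|G|=n\}$.
   Formalization: The case n = 2 is excluded: with the refinement step as defined, dimension 1 never inspects an edge, so the complete and the empty graph on two vertices are not distinguished and WL(2) ≥ 2 > 3/2. *)

theory Defs
  imports Complex_Main "HOL-Library.FSet" "HOL-Library.Ramsey" "HOL-Library.Extended_Real"
begin

record 'a ugraph =
  verts :: "'a fset"
  edges :: "'a set set"

definition simple_graph :: "'a ugraph \<Rightarrow> bool" where
  "simple_graph G \<longleftrightarrow> edges G \<subseteq> [fset (verts G)]\<^bsup>2\<^esup>"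

definition order :: "'a ugraph \<Rightarrow> nat" where
  "order G = fcard (verts G)"

definition adjacent :: "'a ugraph \<Rightarrow> 'a \<Rightarrow> 'a \<Rightarrow> bool" where
  "adjacent G u v \<longleftrightarrow> {u, v} \<in> edges G"

definition isomorphic :: "'a ugraph \<Rightarrow> 'b ugraph \<Rightarrow> bool" where
  "isomorphic G H \<longleftrightarrow> (\<exists>f. bij_betw f (fset (verts G)) (fset (verts H)) \<and>
     (\<forall>u \<in> fset (verts G). \<forall>v \<in> fset (verts G).
        adjacent G u v \<longleftrightarrow> adjacent H (f u) (f v)))"

text \<open>A \<open>k\<close>-tuple is a list of length \<open>k\<close>, indexed from \<open>0\<close>.\<close>

definition tuples :: "nat \<Rightarrow> 'a ugraph \<Rightarrow> 'a list set" where
  "tuples k G = {u. length u = k \<and> set u \<subseteq> fset (verts G)}"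

text \<open>
  The isomorphism type is represented by the pattern of equalities and the pattern of
  adjacencies of a tuple; see \<open>iso_type_eq_iff\<close>.
\<close>

type_synonym iso_type = "(nat \<times> nat) set \<times> (nat \<times> nat) set"

definition iso_type :: "nat \<Rightarrow> 'a ugraph \<Rightarrow> 'a list \<Rightarrow> iso_type" where
  "iso_type k G u =
     ({(i, j). i < k \<and> j < k \<and> u ! i = u ! j},
      {(i, j). i < k \<and> j < k \<and> adjacent G (u ! i) (u ! j)})"

lemma iso_type_eq_iff:
  "iso_type k G u = iso_type k G' v \<longleftrightarrow>
     (\<forall>i<k. \<forall>j<k. (u ! i = u ! j \<longleftrightarrow> v ! i = v ! j) \<and>
        (adjacent G (u ! i) (u ! j) \<longleftrightarrow> adjacent G' (v ! i) (v ! j)))"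
  by (auto simp: iso_type_def set_eq_iff)

text \<open>
  Colors are hereditarily finite objects independent of the graph, so that colors of tuples
  from different graphs can be compared. The second component of \<open>Refined\<close> is a set, not
  a multiset: this is the relaxed version of the algorithm.
\<close>

datatype color = Initial iso_type | Refined color "color list fset"

fun wl_color :: "nat \<Rightarrow> 'a ugraph \<Rightarrow> nat \<Rightarrow> 'a list \<Rightarrow> color" where
  "wl_color k G 0 u = Initial (iso_type k G u)"
| "wl_color k G (Suc r) u =
     Refined (wl_color k G r u)
       ((\<lambda>w. map (\<lambda>i. wl_color k G r (u[i := w])) [0..<k]) |`| verts G)"

text \<open>
  In \<open>wl_rel\<close> and below, the vertex sets of the two graphs are meant to be disjoint. The
  relation is then an equivalence, whose classes form the partition \<open>\<Pi>\<^sup>r\<close>.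
\<close>

definition wl_rel :: "nat \<Rightarrow> 'a ugraph \<Rightarrow> 'a ugraph \<Rightarrow> nat \<Rightarrow> ('a list \<times> 'a list) set" where
  "wl_rel k G G' r = {(u, v). \<exists>H \<in> {G, G'}. \<exists>H' \<in> {G, G'}.
     u \<in> tuples k H \<and> v \<in> tuples k H' \<and> wl_color k H r u = wl_color k H' r v}"

definition wl_partition :: "nat \<Rightarrow> 'a ugraph \<Rightarrow> 'a ugraph \<Rightarrow> nat \<Rightarrow> 'a list set set" where
  "wl_partition k G G' r = (tuples k G \<union> tuples k G') // wl_rel k G G' r"

definition wl_stop :: "nat \<Rightarrow> 'a ugraph \<Rightarrow> 'a ugraph \<Rightarrow> nat" where
  "wl_stop k G G' =
     (LEAST r. r \<ge> 1 \<and> wl_partition k G G' r = wl_partition k G G' (r - 1))"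

definition diagonal_colors :: "nat \<Rightarrow> 'a ugraph \<Rightarrow> nat \<Rightarrow> color set" where
  "diagonal_colors k G r = {wl_color k G r (replicate k u) | u. u \<in> fset (verts G)}"

definition wl_decides_iso :: "nat \<Rightarrow> 'a ugraph \<Rightarrow> 'a ugraph \<Rightarrow> bool" where
  "wl_decides_iso k G G' \<longleftrightarrow>
     diagonal_colors k G (wl_stop k G G') = diagonal_colors k G' (wl_stop k G G')"

definition wl_correct :: "nat \<Rightarrow> 'a ugraph \<Rightarrow> 'a ugraph \<Rightarrow> bool" where
  "wl_correct k G G' \<longleftrightarrow> (wl_decides_iso k G G' \<longleftrightarrow> isomorphic G G')"

text \<open>
  Minimum and maximum are taken in \<open>enat\<close>: \<open>wl_dim G G' = \<infinity>\<close> would mean that no dimension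
  works, so an upper bound on \<open>wl_max n\<close> also asserts that a suitable dimension exists. The
  maximum over no pair of graphs (\<open>n \<le> 1\<close>) is \<open>0\<close>. Everything is invariant under isomorphism,
  so it suffices to let the pairs of graphs have natural numbers as vertices.
\<close>

definition wl_dim :: "'a ugraph \<Rightarrow> 'a ugraph \<Rightarrow> enat" where
  "wl_dim G G' = Inf {enat k | k. k \<ge> 1 \<and> wl_correct k G G'}"

definition wl_max :: "nat \<Rightarrow> enat" where
  "wl_max n = Sup {wl_dim G G' | (G :: nat ugraph) (G' :: nat ugraph).
     simple_graph G \<and> simple_graph G' \<and> fset (verts G) \<inter> fset (verts G') = {} \<and>
     order G = n \<and> order G' = n \<and> \<not> isomorphic G G'}"

text \<open>
  For \<open>k = 1\<close> the substituted tuple \<open>u\<^bsup>1,w\<^esup>\<close> is just \<open>w\<close>, so the refinement step never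
  looks at an edge and all vertices keep the same color. Hence dimension 1 does not
  distinguish the complete from the empty graph on two vertices, and the bound
  \<open>WL(n) \<le> (n + 1) / 2\<close> fails for \<open>n = 2\<close>.
\<close>

lemma not_adjacent_self: "simple_graph G \<Longrightarrow> \<not> adjacent G x x"
  by (auto simp: simple_graph_def adjacent_def nsets_def dest!: subsetD)

lemma wl_color_1_eq:
  assumes "simple_graph G" "simple_graph G'" "verts G \<noteq> {||}" "verts G' \<noteq> {||}"
  shows "wl_color 1 G r [u] = wl_color 1 G' r [v]"
proof (induction r arbitrary: u v)
  case 0
  show ?case
    using assms by (simp add: iso_type_eq_iff not_adjacent_self)
next
  case (Suc r)
  define c where "c = wl_color 1 G r [u]"
  have G: "wl_color 1 G r [w] = c" if "w |\<in>| verts G" for w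
    using Suc.IH[of u v] Suc.IH[of w v] by (simp add: c_def)
  have G': "wl_color 1 G' r [w] = c" for w
    using Suc.IH[of u w] by (simp add: c_def)
  have "(\<lambda>w. [wl_color 1 G r [w]]) |`| verts G = {|[c]|}"
    using assms(3) G by (auto simp: fset_eq_iff)
  moreover have "(\<lambda>w. [wl_color 1 G' r [w]]) |`| verts G' = {|[c]|}"
    using assms(4) G' by (auto simp: fset_eq_iff)
  ultimately show ?case
    using Suc.IH[of u v] by simp
qed

lemma wl_max_2: "\<not> ereal_of_enat (wl_max 2) \<le> ereal ((real 2 + 1) / 2)"
proof -
  define G :: "nat ugraph" where "G = \<lparr>verts = {|0, 1|}, edges = {{0, 1}}\<rparr>"
  define G' :: "nat ugraph" where "G' = \<lparr>verts = {|2, 3|}, edges = {}\<rparr>"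
  have s: "simple_graph G" "simple_graph G'"
    by (auto simp: simple_graph_def G_def G'_def nsets_def)
  have ne: "verts G \<noteq> {||}" "verts G' \<noteq> {||}"
    by (auto simp: G_def G'_def)
  have niso: "\<not> isomorphic G G'"
    by (auto simp: isomorphic_def adjacent_def G_def G'_def)
  have o: "order G = 2" "order G' = 2"
    by (simp_all add: order_def G_def G'_def fcard.rep_eq)
  have d: "fset (verts G) \<inter> fset (verts G') = {}"
    by (auto simp: G_def G'_def)
  have "diagonal_colors 1 G r = diagonal_colors 1 G' r" for r
  proof -
    have const: "diagonal_colors 1 H r = {wl_color 1 G r [0]}"
      if "simple_graph H" "verts H \<noteq> {||}" for H :: "nat ugraph"
    proof -
      have eq: "wl_color 1 H r (replicate 1 u) = wl_color 1 G r [0]" for u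
        using wl_color_1_eq[OF that(1) s(1) that(2) ne(1), of r u 0] by simp
      show ?thesis
        unfolding diagonal_colors_def eq using that(2) by auto
    qed
    show ?thesis
      using const s ne by simp
  qed
  then have "\<not> wl_correct 1 G G'"
    using niso by (simp add: wl_correct_def wl_decides_iso_def)
  then have "2 \<le> k" if "k \<ge> 1" "wl_correct k G G'" for k
    using that by (cases "k = 1") auto
  then have "enat 2 \<le> wl_dim G G'"
    unfolding wl_dim_def by (intro Inf_greatest) auto
  also have "\<dots> \<le> wl_max 2"
    unfolding wl_max_def using s d o niso by (intro Sup_upper) blast
  finally have "ereal_of_enat (enat 2) \<le> ereal_of_enat (wl_max 2)"
    by (simp only: ereal_of_enat_le_iff)
  then have "ereal 2 \<le> ereal_of_enat (wl_max 2)"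
    by simp
  moreover have "ereal ((real 2 + 1) / 2) < ereal 2"
    by simp
  ultimately show ?thesis
    by (meson leD order.strict_trans2)
qed

end

theory Submission
  imports Defs
begin

text \<open>
  If dimension \<open>k \<ge> 2\<close> fails on \<open>G, H\<close>, equality of stable colors is a winning strategy for
  Duplicator in the \<open>k + 1\<close>-round Ehrenfeucht--Fraisse game. So it is enough that Spoiler wins on
  non-isomorphic graphs of order \<open>n\<close> within \<open>K\<close> rounds when \<open>2 K \<ge> n + 2\<close>.

  Call vertices outside \<open>X\<close> equivalent if they have the same neighbors in \<open>X\<close>. Let \<open>X\<close> be as large
  as possible subject to having at least \<open>|X| + 1\<close> classes; then \<open>2 |X| + 1 \<le> n\<close>, and no vertex of a
  class of size at least two splits any class. Spoiler first plays \<open>X\<close>, and \<open>q = K - |X| \<ge> 2\<close> rounds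
  are left. A class whose sizes in the two graphs differ must have at least \<open>q\<close> elements in both,
  since Duplicator has to match \<open>q\<close> elements. As the orders agree, there are two such classes,
  which together with \<open>X\<close> and one vertex of every other class exceed the order. So class sizes agree,
  and singleton classes \<open>Y\<close> can be treated as played at the cost of one round. The same count inside
  a class, with \<open>q - 1\<close> rounds, shows that types over \<open>X \<union> Y\<close> occur equally often in both graphs.
  Adjacency between the remaining vertices depends only on their classes, so \<open>G\<close> and \<open>H\<close> are
  isomorphic.
\<close>

section \<open>Counting fibres\<close>

lemma sum_card_fibres:
  assumes "finite A" "finite T" "F ` A \<subseteq> T"
  shows "(\<Sum>t\<in>T. card {a \<in> A. F a = t}) = card A"
  using sum.group[OF assms, of "\<lambda>_. 1::nat"] assms(1) by simp

text \<open>Each of the other values is attained outside this fibre, so at least (number of values)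
  - 1 points lie outside it.\<close>

lemma card_fibre_bound:
  assumes "finite A" "t \<in> F ` A"
  shows "card {a \<in> A. F a = t} + card (F ` A) \<le> card A + 1"
proof -
  have "card (F ` A - {t}) \<le> card (A - {a \<in> A. F a = t})"
    by (rule surj_card_le[of _ _ F]) (use assms in auto)
  moreover have "card (A - {a \<in> A. F a = t}) = card A - card {a \<in> A. F a = t}"
    by (rule card_Diff_subset) (use assms in auto)
  moreover have "card {a \<in> A. F a = t} \<le> card A"
    by (rule card_mono) (use assms in auto)
  moreover have "card (F ` A - {t}) = card (F ` A) - 1"
    using assms by simp
  ultimately show ?thesis by linarith
qed

lemma card_two_fibres_bound:
  assumes "finite A" "s \<in> F ` A" "t \<in> F ` A" "s \<noteq> t"
  shows "card {a \<in> A. F a = s} + card {a \<in> A. F a = t} + card (F ` A) \<le> card A + 2"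
proof -
  let ?A = "A - {a \<in> A. F a = s}"
  have eq: "{a \<in> ?A. F a = t} = {a \<in> A. F a = t}" "F ` ?A = F ` A - {s}"
    using assms by auto
  have "card {a \<in> ?A. F a = t} + card (F ` ?A) \<le> card ?A + 1"
    by (rule card_fibre_bound) (use assms in auto)
  moreover have "card ?A = card A - card {a \<in> A. F a = s}"
    by (rule card_Diff_subset) (use assms in auto)
  moreover have "card {a \<in> A. F a = s} \<le> card A"
    by (rule card_mono) (use assms in auto)
  moreover have "card (F ` A - {s}) = card (F ` A) - 1"
    using assms by simp
  moreover have "card (F ` A) > 0"
    using assms by (auto simp: card_gt_0_iff)
  ultimately show ?thesis
    unfolding eq by linarith
qed

text \<open>If the total is the same, one disagreement in fibre sizes forces a second one of
  opposite sign, and both of these fibres have at least \<open>r\<close> elements.\<close>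

lemma fibre_cards_agree:
  assumes fin: "finite A" "finite B" and "card A = card B" "r \<ge> 1"
    and le: "\<And>t. min r (card {a \<in> A. F a = t}) \<le> card {b \<in> B. F' b = t}"
    and ge: "\<And>t. min r (card {b \<in> B. F' b = t}) \<le> card {a \<in> A. F a = t}"
    and bound: "card A \<le> 2 * r \<or> card A + 2 \<le> 2 * r + card (F ` A)"
  shows "card {a \<in> A. F a = t} = card {b \<in> B. F' b = t}"
proof (rule ccontr)
  define c where "c t = card {a \<in> A. F a = t}" for t
  define d where "d t = card {b \<in> B. F' b = t}" for t
  define T where "T = F ` A \<union> F' ` B"
  assume "card {a \<in> A. F a = t} \<noteq> card {b \<in> B. F' b = t}"
  then have ne: "c t \<noteq> d t" by (simp add: c_def d_def)
  have finT: "finite T" using fin by (simp add: T_def)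
  have sums: "sum c T = card A" "sum d T = card B"
    unfolding c_def d_def by (rule sum_card_fibres; use fin in \<open>simp add: T_def\<close>)+
  have out: "c s = 0 \<and> d s = 0" if "s \<notin> T" for s
  proof -
    have "{a \<in> A. F a = s} = {}" "{b \<in> B. F' b = s} = {}"
      using that by (auto simp: T_def)
    then show ?thesis unfolding c_def d_def by (simp only: card.empty)
  qed
  have "t \<in> T" using out ne by force
  have lt: "\<exists>s\<in>T. c s < d s"
  proof (rule ccontr)
    assume "\<not> ?thesis"
    then have "\<forall>s\<in>T. d s \<le> c s" "d t < c t"
      using \<open>t \<in> T\<close> ne by (auto simp: not_less order.strict_iff_order)
    then have "sum d T < sum c T"
      using \<open>t \<in> T\<close> finT by (intro sum_strict_mono_ex1) auto
    then show False using sums assms(3) by simp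
  qed
  have gt: "\<exists>s\<in>T. d s < c s"
  proof (rule ccontr)
    assume "\<not> ?thesis"
    then have "\<forall>s\<in>T. c s \<le> d s" "c t < d t"
      using \<open>t \<in> T\<close> ne by (auto simp: not_less order.strict_iff_order)
    then have "sum c T < sum d T"
      using \<open>t \<in> T\<close> finT by (intro sum_strict_mono_ex1) auto
    then show False using sums assms(3) by simp
  qed
  obtain s1 s2 where s: "c s1 < d s1" "d s2 < c s2" using lt gt by blast
  have "s1 \<noteq> s2" using s by auto
  \<comment> \<open>At \<open>s1\<close> the minimum in \<open>ge\<close> is at most
    \<open>c s1 < d s1\<close>, so it must be \<open>r\<close>; at \<open>s2\<close>,
    \<open>le\<close> gives \<open>r \<le> d s2 < c s2\<close> in the same way. The strict
    inequality is the unit that contradicts \<open>bound\<close>.\<close>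
  have r: "r \<le> c s1" "r < c s2"
    using le[of s2] ge[of s1] s by (auto simp: c_def d_def)
  have mem: "s \<in> F ` A" if "c s > 0" for s
    using that by (auto simp: c_def card_gt_0_iff)
  have s_in: "s1 \<in> F ` A" "s2 \<in> F ` A"
    using r \<open>r \<ge> 1\<close> mem by auto
  have "c s1 + c s2 + card (F ` A) \<le> card A + 2"
    unfolding c_def using fin s_in \<open>s1 \<noteq> s2\<close> by (intro card_two_fibres_bound)
  \<comment> \<open>Only the first alternative of \<open>bound\<close> needs this: with two values,
    both fibres together have at most \<open>card A\<close> elements.\<close>
  moreover have "card {s1, s2} \<le> card (F ` A)"
    by (rule card_mono) (use fin s_in in auto)
  ultimately show False
    using bound r \<open>s1 \<noteq> s2\<close> by simp
qed

lemma bij_betw_fibres: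
  assumes fin: "finite A" "finite B"
    and card: "\<And>t. card {a \<in> A. F a = t} = card {b \<in> B. F' b = t}"
  obtains g where "bij_betw g A B" "\<And>a. a \<in> A \<Longrightarrow> F' (g a) = F a"
proof -
  have "\<exists>g. bij_betw g {a \<in> A. F a = t} {b \<in> B. F' b = t}" for t
    using fin card by (intro finite_same_card_bij) auto
  then obtain g where g: "\<And>t. bij_betw (g t) {a \<in> A. F a = t} {b \<in> B. F' b = t}"
    by metis
  define h where "h a = g (F a) a" for a
  have h: "h a \<in> B \<and> F' (h a) = F a" if "a \<in> A" for a
    using bij_betwE[OF g[of "F a"]] that by (auto simp: h_def)
  have "inj_on h A"
  proof (rule inj_onI)
    fix a b assume ab: "a \<in> A" "b \<in> A" "h a = h b"
    then have "F a = F b" using h by metis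
    then show "a = b"
      using ab bij_betw_imp_inj_on[OF g[of "F b"]] by (auto simp: h_def dest: inj_onD)
  qed
  moreover have "b \<in> h ` A" if "b \<in> B" for b
  proof -
    have "b \<in> g (F' b) ` {a \<in> A. F a = F' b}"
      using bij_betw_imp_surj_on[OF g[of "F' b"]] that by auto
    then obtain a where "a \<in> A" "F a = F' b" "b = g (F' b) a" by auto
    then have "b = h a" by (simp add: h_def)
    then show ?thesis using \<open>a \<in> A\<close> by blast
  qed
  ultimately have "bij_betw h A B"
    using h by (auto simp: bij_betw_def)
  then show ?thesis using that h by blast
qed

section \<open>The Ehrenfeucht--Fraisse game\<close>

lemma adjacent_sym: "adjacent G u v \<longleftrightarrow> adjacent G v u"
  by (simp add: adjacent_def insert_commute)

text \<open>A position is a relation, not a function, so that moves in either graph are treated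
  alike; the equality clause makes it a bijection between the played vertices.\<close>

definition partial_iso :: "'a ugraph \<Rightarrow> 'b ugraph \<Rightarrow> ('a \<times> 'b) set \<Rightarrow> bool" where
  "partial_iso G H P \<longleftrightarrow> (\<forall>a b c d. (a, b) \<in> P \<longrightarrow> (c, d) \<in> P \<longrightarrow>
     (a = c \<longleftrightarrow> b = d) \<and> (adjacent G a c \<longleftrightarrow> adjacent H b d))"

lemma partial_isoD:
  assumes "partial_iso G H P" "(a, b) \<in> P" "(c, d) \<in> P"
  shows "a = c \<longleftrightarrow> b = d" "adjacent G a c \<longleftrightarrow> adjacent H b d"
  using assms unfolding partial_iso_def by blast+

lemma partial_iso_mono: "partial_iso G H P \<Longrightarrow> Q \<subseteq> P \<Longrightarrow> partial_iso G H Q"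
  unfolding partial_iso_def by blast

lemma partial_iso_converse: "partial_iso H G (P\<inverse>) \<longleftrightarrow> partial_iso G H P"
  unfolding partial_iso_def converse_iff by blast

text \<open>\<open>ef G H m P\<close>: Duplicator survives \<open>m\<close> further rounds from the position \<open>P\<close>.\<close>

primrec ef :: "'a ugraph \<Rightarrow> 'b ugraph \<Rightarrow> nat \<Rightarrow> ('a \<times> 'b) set \<Rightarrow> bool" where
  "ef G H 0 P = partial_iso G H P"
| "ef G H (Suc m) P = (partial_iso G H P \<and>
     (\<forall>a \<in> fset (verts G). \<exists>b \<in> fset (verts H). ef G H m (insert (a, b) P)) \<and>
     (\<forall>b \<in> fset (verts H). \<exists>a \<in> fset (verts G). ef G H m (insert (a, b) P)))"

lemma ef_partial_iso: "ef G H m P \<Longrightarrow> partial_iso G H P"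
  by (cases m) auto

lemma ef_forth:
  assumes "ef G H m P" "m \<ge> 1" "a \<in> fset (verts G)"
  obtains b where "b \<in> fset (verts H)" "ef G H (m - 1) (insert (a, b) P)"
proof -
  obtain l where "m = Suc l" using assms(2) by (cases m) auto
  then have "\<exists>b \<in> fset (verts H). ef G H (m - 1) (insert (a, b) P)"
    using assms(1,3) by simp
  then show ?thesis using that by blast
qed

lemma ef_back:
  assumes "ef G H m P" "m \<ge> 1" "b \<in> fset (verts H)"
  obtains a where "a \<in> fset (verts G)" "ef G H (m - 1) (insert (a, b) P)"
proof -
  obtain l where "m = Suc l" using assms(2) by (cases m) auto
  then have "\<exists>a \<in> fset (verts G). ef G H (m - 1) (insert (a, b) P)"
    using assms(1,3) by simp
  then show ?thesis using that by blast
qed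

lemma ef_mono: "ef G H m P \<Longrightarrow> Q \<subseteq> P \<Longrightarrow> ef G H m Q"
proof (induction m arbitrary: P Q)
  case 0
  then show ?case by (auto intro: partial_iso_mono)
next
  case (Suc m)
  have *: "ef G H m (insert p Q)" if "ef G H m (insert p P)" for p
    by (rule Suc.IH[OF that]) (use Suc.prems(2) in blast)
  have "partial_iso G H Q"
    using Suc.prems partial_iso_mono by auto
  moreover have "\<exists>b \<in> fset (verts H). ef G H m (insert (a, b) Q)" if "a \<in> fset (verts G)" for a
    by (rule ef_forth[OF Suc.prems(1) _ that]) (use * in auto)
  moreover have "\<exists>a \<in> fset (verts G). ef G H m (insert (a, b) Q)" if "b \<in> fset (verts H)" for b
    by (rule ef_back[OF Suc.prems(1) _ that]) (use * in auto)
  ultimately show ?case unfolding ef.simps by blast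
qed

lemma ef_converse: "ef H G m (P\<inverse>) \<longleftrightarrow> ef G H m P"
proof (induction m arbitrary: P)
  case 0
  then show ?case by (simp add: partial_iso_converse)
next
  case (Suc m)
  have "ef H G m (insert (b, a) (P\<inverse>)) \<longleftrightarrow> ef G H m (insert (a, b) P)" for a b
  proof -
    have "insert (b, a) (P\<inverse>) = (insert (a, b) P)\<inverse>" by blast
    then show ?thesis using Suc.IH[of "insert (a, b) P"] by (simp only:)
  qed
  then show ?case
    by (simp only: ef.simps partial_iso_converse) blast
qed

text \<open>Let Spoiler spend a round on an arbitrary vertex, then forget the new pair; a vertex
  must exist for this.\<close>

lemma ef_antimono: "ef G H m P \<Longrightarrow> l \<le> m \<Longrightarrow> verts G \<noteq> {||} \<Longrightarrow> ef G H l P"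
proof (induction m arbitrary: l)
  case (Suc m)
  obtain a where "a \<in> fset (verts G)" using Suc.prems(3) by auto
  then obtain b where "ef G H m (insert (a, b) P)"
    using ef_forth[OF Suc.prems(1)] by auto
  then have m: "ef G H m P" by (rule ef_mono) blast
  show ?case
  proof (cases "l = Suc m")
    case True
    then show ?thesis using Suc.prems(1) by (simp only:)
  next
    case False
    then show ?thesis using Suc.IH[OF m] Suc.prems(2,3) by simp
  qed
qed simp

abbreviation fun_graph :: "('a \<Rightarrow> 'b) \<Rightarrow> 'a set \<Rightarrow> ('a \<times> 'b) set" where
  "fun_graph f X \<equiv> (\<lambda>x. (x, f x)) ` X"

lemma ef_play_set:
  assumes "finite S" "S \<subseteq> fset (verts G)" "ef G H (card S + m) P"
  obtains f where "f ` S \<subseteq> fset (verts H)" "ef G H m (P \<union> fun_graph f S)"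
  using assms
proof (induction S arbitrary: P thesis rule: finite_induct)
  case empty
  then show ?case by simp
next
  case (insert x S)
  then have "ef G H (Suc (card S + m)) P" by simp
  from ef_forth[OF this]
  obtain b where b: "b \<in> fset (verts H)" "ef G H (card S + m) (insert (x, b) P)"
    using insert.prems(2) by auto
  obtain f where f: "f ` S \<subseteq> fset (verts H)"
      "ef G H m (insert (x, b) P \<union> fun_graph f S)"
    using insert.IH[OF _ _ b(2)] insert.prems by blast
  have "insert (x, b) P \<union> fun_graph f S = P \<union> fun_graph (f(x := b)) (insert x S)"
    using insert.hyps by (auto simp: image_iff)
  then have "ef G H m (P \<union> fun_graph (f(x := b)) (insert x S))"
    using f(2) by simp
  moreover have "(f(x := b)) ` insert x S \<subseteq> fset (verts H)"
    using f(1) b(1) by auto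
  ultimately show ?case
    using insert.prems(1) by blast
qed

lemma partial_iso_fun_graph_inj:
  assumes "partial_iso G H P" "fun_graph f S \<subseteq> P"
  shows "inj_on f S"
proof (rule inj_onI)
  fix x y assume "x \<in> S" "y \<in> S" "f x = f y"
  then show "x = y"
    using partial_isoD(1)[OF assms(1), of x "f x" y "f y"] assms(2) by blast
qed

text \<open>Spoiler plays \<open>min r (card A)\<close> vertices of \<open>A\<close>. The replies
  are distinct, and the \<open>e\<close> rounds kept in reserve are what \<open>step\<close> uses to
  force each reply into \<open>B\<close>.\<close>

lemma ef_card_le:
  assumes ef: "ef G H (r + e) P" and A: "A \<subseteq> fset (verts G)" and "finite B"
    and step: "\<And>a b. a \<in> A \<Longrightarrow> b \<in> fset (verts H) \<Longrightarrow> ef G H e (insert (a, b) P) \<Longrightarrow> b \<in> B"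
  shows "min r (card A) \<le> card B"
proof (cases "A = {}")
  case False
  then have ne: "verts G \<noteq> {||}" using A by auto
  obtain S where S: "S \<subseteq> A" "card S = min r (card A)"
    using obtain_subset_with_card_n[of "min r (card A)" A] by auto
  have "finite S" using S(1) A finite_fset finite_subset by metis
  moreover have "ef G H (card S + e) P"
    using ef_antimono[OF ef _ ne] S(2) by simp
  ultimately obtain f where f: "f ` S \<subseteq> fset (verts H)" "ef G H e (P \<union> fun_graph f S)"
    using ef_play_set[of S G H e P] S(1) A by blast
  have "inj_on f S"
    by (rule partial_iso_fun_graph_inj[OF ef_partial_iso[OF f(2)]]) simp
  moreover have "f ` S \<subseteq> B"
  proof safe
    fix x assume "x \<in> S"
    then have "ef G H e (insert (x, f x) P)"
      by (intro ef_mono[OF f(2)]) auto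
    then show "f x \<in> B" using step \<open>x \<in> S\<close> S(1) f(1) by blast
  qed
  ultimately show ?thesis
    using card_inj_on_le[of f S B] \<open>finite B\<close> S(2) by simp
qed simp

lemma ef_card_ge:
  assumes ef: "ef G H (r + e) P" and B: "B \<subseteq> fset (verts H)" and "finite A"
    and step: "\<And>a b. b \<in> B \<Longrightarrow> a \<in> fset (verts G) \<Longrightarrow> ef G H e (insert (a, b) P) \<Longrightarrow> a \<in> A"
  shows "min r (card B) \<le> card A"
proof (rule ef_card_le)
  show "ef H G (r + e) (P\<inverse>)" using ef by (simp add: ef_converse)
  fix b a assume "b \<in> B" "a \<in> fset (verts G)" "ef H G e (insert (b, a) (P\<inverse>))"
  moreover have "insert (b, a) (P\<inverse>) = (insert (a, b) P)\<inverse>" by auto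
  ultimately show "a \<in> A" using step by (simp add: ef_converse)
qed (use assms in auto)

section \<open>Reconstructing an isomorphism\<close>

text \<open>The neighbors of \<open>b\<close> among the images of \<open>X\<close> are pulled back
  to \<open>X\<close>. With \<open>f = id\<close> for the first graph, traces of both graphs are
  subsets of the same \<open>X\<close> and can be compared directly.\<close>

definition trace :: "'b ugraph \<Rightarrow> ('a \<Rightarrow> 'b) \<Rightarrow> 'a set \<Rightarrow> 'b \<Rightarrow> 'a set" where
  "trace H f X b = {x \<in> X. adjacent H b (f x)}"

lemma trace_Int: "X \<subseteq> W \<Longrightarrow> (\<And>x. x \<in> X \<Longrightarrow> f x = h x) \<Longrightarrow> trace H f X b = trace H h W b \<inter> X"
  by (auto simp: trace_def)

lemma partial_iso_trace:
  assumes "partial_iso G H (insert (a, b) (fun_graph f X))"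
  shows "trace G id X a = trace H f X b" "a \<in> X \<longleftrightarrow> b \<in> f ` X" "a \<in> X \<Longrightarrow> b = f a"
    "x \<in> X \<Longrightarrow> b = f x \<Longrightarrow> a = x"
proof -
  have *: "(a = x \<longleftrightarrow> b = f x) \<and> (adjacent G a x \<longleftrightarrow> adjacent H b (f x))" if "x \<in> X" for x
    using partial_isoD[OF assms, of a b x "f x"] that by auto
  then show "trace G id X a = trace H f X b" "a \<in> X \<longleftrightarrow> b \<in> f ` X" "a \<in> X \<Longrightarrow> b = f a"
    "x \<in> X \<Longrightarrow> b = f x \<Longrightarrow> a = x"
    by (auto simp: trace_def)
qed

text \<open>Extend \<open>h\<close> by any trace-preserving bijection \<open>g\<close> of the
  remaining vertices, which exists by \<open>card\<close>. Traces settle the edges between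
  \<open>W\<close> and the rest; \<open>adj\<close> settles those within the rest for every choice
  of \<open>g\<close>.\<close>

lemma isomorphicI_traces:
  assumes simple: "simple_graph G" "simple_graph H"
    and W: "W \<subseteq> fset (verts G)" "h ` W \<subseteq> fset (verts H)" "partial_iso G H (fun_graph h W)"
    and card: "\<And>t. card {a \<in> fset (verts G) - W. trace G id W a = t} =
                 card {b \<in> fset (verts H) - h ` W. trace H h W b = t}"
    and adj: "\<And>a c b d. a \<in> fset (verts G) - W \<Longrightarrow> c \<in> fset (verts G) - W \<Longrightarrow> a \<noteq> c \<Longrightarrow>
        b \<in> fset (verts H) - h ` W \<Longrightarrow> d \<in> fset (verts H) - h ` W \<Longrightarrow> b \<noteq> d \<Longrightarrow>
        trace G id W a = trace H h W b \<Longrightarrow> trace G id W c = trace H h W d \<Longrightarrow>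
        adjacent G a c \<longleftrightarrow> adjacent H b d"
  shows "isomorphic G H"
proof -
  let ?Z = "fset (verts G) - W" and ?Z' = "fset (verts H) - h ` W"
  obtain g where g: "bij_betw g ?Z ?Z'" "\<And>a. a \<in> ?Z \<Longrightarrow> trace H h W (g a) = trace G id W a"
    using bij_betw_fibres[of ?Z ?Z' "trace G id W" "trace H h W"] card by auto
  define \<phi> where "\<phi> a = (if a \<in> W then h a else g a)" for a
  have "inj_on h W" by (rule partial_iso_fun_graph_inj[OF W(3)]) simp
  then have "bij_betw \<phi> W (h ` W)"
    by (auto simp: bij_betw_def inj_on_def \<phi>_def)
  moreover have "bij_betw \<phi> ?Z ?Z'"
    using g(1) by (subst bij_betw_cong[of _ _ g]) (auto simp: \<phi>_def)
  ultimately have "bij_betw \<phi> (W \<union> ?Z) (h ` W \<union> ?Z')"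
    by (rule bij_betw_combine) auto
  then have bij: "bij_betw \<phi> (fset (verts G)) (fset (verts H))"
    using W by (simp add: Un_absorb1)
  have gZ: "g a \<in> ?Z'" if "a \<in> ?Z" for a using bij_betwE[OF g(1)] that by blast
  have mixed: "adjacent G a w \<longleftrightarrow> adjacent H (g a) (h w)" if "a \<in> ?Z" "w \<in> W" for a w
    using g(2)[OF that(1)] that(2) by (auto simp: trace_def)
  have "adjacent G u v \<longleftrightarrow> adjacent H (\<phi> u) (\<phi> v)"
    if uv: "u \<in> fset (verts G)" "v \<in> fset (verts G)" for u v
  proof -
    consider "u \<in> W" "v \<in> W" | "u \<in> W" "v \<in> ?Z" | "u \<in> ?Z" "v \<in> W"
      | "u = v" | "u \<in> ?Z" "v \<in> ?Z" "u \<noteq> v"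
      using uv by blast
    then show ?thesis
    proof cases
      case 1
      then show ?thesis
        using partial_isoD(2)[OF W(3), of u "h u" v "h v"] by (simp add: \<phi>_def)
    next
      case 2
      then show ?thesis using mixed[of v u] by (simp add: \<phi>_def adjacent_sym)
    next
      case 3
      then show ?thesis using mixed[of u v] by (simp add: \<phi>_def)
    next
      case 4
      then show ?thesis using simple by (simp add: not_adjacent_self)
    next
      case 5
      then have "g u \<noteq> g v"
        using bij_betw_imp_inj_on[OF g(1)] by (auto dest: inj_onD)
      then have "adjacent G u v \<longleftrightarrow> adjacent H (g u) (g v)"
        using 5 gZ g(2) by (intro adj) auto
      then show ?thesis using 5 by (simp add: \<phi>_def)
    qed
  qed
  then show ?thesis using bij unfolding isomorphic_def by blast
qed

text \<open>The assumption \<open>rounds\<close> is what remains of \<open>order G + 2 \<le> 2 * (card X + q)\<close> once the number of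
  classes is at least \<open>card X + 1\<close>; it implies \<open>q \<ge> 2\<close>.\<close>

locale ef_position =
  fixes G :: "'a ugraph" and H :: "'b ugraph" and X :: "'a set" and f :: "'a \<Rightarrow> 'b" and q :: nat
  assumes simple: "simple_graph G" "simple_graph H"
    and order_eq: "order G = order H"
    and X: "X \<subseteq> fset (verts G)" "f ` X \<subseteq> fset (verts H)"
    and ef: "ef G H q (fun_graph f X)"
    and rounds: "card (fset (verts G) - X) + 3 \<le> 2 * q + card (trace G id X ` (fset (verts G) - X))"
    and homogeneous: "\<And>u v c d. \<lbrakk>u \<in> fset (verts G) - X; v \<in> fset (verts G) - X; u \<noteq> v;
        trace G id X u = trace G id X v; c \<in> fset (verts G) - X; d \<in> fset (verts G) - X;
        u \<noteq> c; u \<noteq> d; trace G id X c = trace G id X d\<rbrakk> \<Longrightarrow> adjacent G u c \<longleftrightarrow> adjacent G u d"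
begin

definition "A = fset (verts G) - X"
definition "B = fset (verts H) - f ` X"

definition cl where "cl t = {a \<in> A. trace G id X a = t}"
definition cl' where "cl' t = {b \<in> B. trace H f X b = t}"

lemma fin [simp]: "finite A" "finite B" "finite (cl t)" "finite (cl' t)"
  by (simp_all add: A_def B_def cl_def cl'_def)

lemma q_ge_2: "q \<ge> 2"
  using rounds card_image_le[of "fset (verts G) - X" "trace G id X"] by simp

lemma card_A_B: "card A = card B"
proof -
  have "inj_on f X"
    by (rule partial_iso_fun_graph_inj[OF ef_partial_iso[OF ef]]) simp
  then have "card (f ` X) = card X" by (rule card_image)
  then show ?thesis
    using order_eq X finite_subset[OF X(1)] finite_subset[OF X(2)]
    by (simp add: A_def B_def card_Diff_subset order_def fcard.rep_eq)
qed

lemma partial_iso_cl: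
  assumes "partial_iso G H (insert (a, b) (fun_graph f X))" "a \<in> fset (verts G)" "b \<in> fset (verts H)"
  shows "a \<in> cl t \<longleftrightarrow> b \<in> cl' t"
  unfolding cl_def cl'_def A_def B_def
  using partial_iso_trace(1,2)[OF assms(1)] assms(2,3) by simp

text \<open>All \<open>q\<close> rounds are spent in one class, with no round in reserve: the
  position itself forces every reply into the class with the same trace.\<close>

lemma card_cl: "card (cl t) = card (cl' t)"
  unfolding cl_def cl'_def
proof (rule fibre_cards_agree)
  show "card A = card B" by (rule card_A_B)
  show "1 \<le> q" using q_ge_2 by simp
  show "card A \<le> 2 * q \<or> card A + 2 \<le> 2 * q + card (trace G id X ` A)"
    using rounds by (auto simp: A_def)
  fix t
  have "min q (card (cl t)) \<le> card (cl' t)"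
  proof (rule ef_card_le)
    show "ef G H (q + 0) (fun_graph f X)" using ef by simp
    show sub: "cl t \<subseteq> fset (verts G)" by (auto simp: cl_def A_def)
    show "b \<in> cl' t" if "a \<in> cl t" "b \<in> fset (verts H)" "ef G H 0 (insert (a, b) (fun_graph f X))" for a b
      using partial_iso_cl[OF ef_partial_iso[OF that(3)] _ that(2)] that(1) sub by blast
  qed simp
  then show "min q (card {a \<in> A. trace G id X a = t}) \<le> card {b \<in> B. trace H f X b = t}"
    by (simp add: cl_def cl'_def)
  have "min q (card (cl' t)) \<le> card (cl t)"
  proof (rule ef_card_ge)
    show "ef G H (q + 0) (fun_graph f X)" using ef by simp
    show sub: "cl' t \<subseteq> fset (verts H)" by (auto simp: cl'_def B_def)
    show "a \<in> cl t" if "b \<in> cl' t" "a \<in> fset (verts G)" "ef G H 0 (insert (a, b) (fun_graph f X))" for a b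
      using partial_iso_cl[OF ef_partial_iso[OF that(3)] that(2)] that(1) sub by blast
  qed simp
  then show "min q (card {b \<in> B. trace H f X b = t}) \<le> card {a \<in> A. trace G id X a = t}"
    by (simp add: cl_def cl'_def)
qed simp_all

section \<open>Singleton classes treated as played\<close>

definition "Y = {a \<in> A. card (cl (trace G id X a)) = 1}"
definition "W = X \<union> Y"
text \<open>On \<open>Y\<close> the description is unique because \<open>card_cl\<close> makes the
  corresponding class of \<open>H\<close> a singleton too.\<close>

definition h where "h x = (if x \<in> X then f x else (THE b. b \<in> cl' (trace G id X x)))"

lemma cl_Y: "y \<in> Y \<Longrightarrow> cl (trace G id X y) = {y}"
proof -
  assume y: "y \<in> Y"
  then have "card (cl (trace G id X y)) = 1" by (simp add: Y_def)
  then obtain z where "cl (trace G id X y) = {z}" by (rule card_1_singletonE)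
  moreover have "y \<in> cl (trace G id X y)" using y by (simp add: Y_def cl_def)
  ultimately show ?thesis by simp
qed

lemma cl'_Y:
  assumes "y \<in> Y"
  shows "cl' (trace G id X y) = {h y}"
proof -
  have "card (cl' (trace G id X y)) = 1"
    using assms card_cl by (simp add: Y_def)
  then obtain b where "cl' (trace G id X y) = {b}" by (auto simp: card_1_singleton_iff)
  moreover have "y \<notin> X" using assms by (simp add: Y_def A_def)
  ultimately show ?thesis by (simp add: h_def)
qed

lemma h_X: "x \<in> X \<Longrightarrow> h x = f x"
  by (simp add: h_def)

lemma W_subset: "W \<subseteq> fset (verts G)"
  using X by (auto simp: W_def Y_def A_def)

lemma h_W_subset: "h ` W \<subseteq> fset (verts H)"
proof
  fix b assume "b \<in> h ` W"
  then obtain w where w: "w \<in> W" "b = h w" by blast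
  show "b \<in> fset (verts H)"
  proof (cases "w \<in> X")
    case True
    then show ?thesis using X(2) w by (auto simp: h_X)
  next
    case False
    then have "w \<in> Y" using w(1) by (simp add: W_def)
    then have "b \<in> cl' (trace G id X w)" using cl'_Y w(2) by simp
    then show ?thesis by (simp add: cl'_def B_def)
  qed
qed

text \<open>The same description as that of \<open>Y\<close>, now within \<open>H\<close>; hence
  deleting \<open>Y\<close> and \<open>h\<close> of \<open>Y\<close> removes corresponding classes
  in the two graphs.\<close>

lemma h_Y: "h ` Y = {b \<in> B. card (cl' (trace H f X b)) = 1}"
proof safe
  fix y assume y: "y \<in> Y"
  then have hy: "h y \<in> cl' (trace G id X y)" using cl'_Y by simp
  then show "h y \<in> B" by (simp add: cl'_def)
  have "trace H f X (h y) = trace G id X y" using hy by (simp add: cl'_def)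
  then show "card (cl' (trace H f X (h y))) = 1" using y by (simp add: cl'_Y)
next
  fix b assume b: "b \<in> B" "card (cl' (trace H f X b)) = 1"
  then obtain y where y: "cl (trace H f X b) = {y}"
    using card_cl by (metis card_1_singletonE)
  then have eq: "y \<in> A" "trace G id X y = trace H f X b" by (auto simp: cl_def)
  then have "y \<in> Y" using y by (simp add: Y_def)
  moreover have "b \<in> cl' (trace G id X y)" using b eq by (simp add: cl'_def)
  ultimately show "b \<in> h ` Y" using cl'_Y by blast
qed

text \<open>A vertex of \<open>Y\<close> is identified by its trace on \<open>X\<close> alone, so a
  pair consistent with \<open>f\<close> on \<open>X\<close> automatically respects \<open>h\<close>
  on all of \<open>W\<close>.\<close>

lemma reply_W:
  assumes "partial_iso G H (insert (a, b) (fun_graph f X))" "a \<in> fset (verts G)" "b \<in> fset (verts H)"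
    and "w \<in> W"
  shows "a = w \<longleftrightarrow> b = h w"
proof (cases "w \<in> X")
  case True
  then show ?thesis
    using partial_iso_trace(3)[OF assms(1)] partial_iso_trace(4)[OF assms(1) True] h_X[OF True]
    by metis
next
  case False
  then have "w \<in> Y" using assms(4) by (simp add: W_def)
  then show ?thesis
    using partial_iso_cl[OF assms(1-3), of "trace G id X w"] cl_Y cl'_Y by simp
qed

lemma play_W:
  assumes "ef G H m Q" "m \<ge> 1" "fun_graph f X \<subseteq> Q" "w \<in> W"
  shows "ef G H (m - 1) (insert (w, h w) Q)"
proof -
  have w: "w \<in> fset (verts G)" using assms(4) W_subset by blast
  obtain b where b: "b \<in> fset (verts H)" "ef G H (m - 1) (insert (w, b) Q)"
    using ef_forth[OF assms(1,2) w] by blast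
  have "partial_iso G H (insert (w, b) (fun_graph f X))"
    using assms(3) by (intro partial_iso_mono[OF ef_partial_iso[OF b(2)]]) auto
  then have "b = h w" using reply_W w b(1) assms(4) by blast
  then show ?thesis using b(2) by simp
qed

text \<open>Any violation involves only two vertices of \<open>W\<close>. Playing these two takes
  two rounds, and \<open>q\<close> is at least 2.\<close>

lemma partial_iso_W: "partial_iso G H (fun_graph h W)"
  unfolding partial_iso_def
proof safe
  fix v w assume vw: "v \<in> W" "w \<in> W"
  have 1: "ef G H (q - 1) (insert (v, h v) (fun_graph f X))"
    using play_W[OF ef _ _ vw(1)] q_ge_2 by simp
  have "ef G H (q - 1 - 1) (insert (w, h w) (insert (v, h v) (fun_graph f X)))"
    by (rule play_W[OF 1 _ _ vw(2)]) (use q_ge_2 in auto)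
  then have "partial_iso G H (insert (w, h w) (insert (v, h v) (fun_graph f X)))"
    by (rule ef_partial_iso)
  from partial_isoD[OF this, of v "h v" w "h w"]
  have *: "v = w \<longleftrightarrow> h v = h w" "adjacent G v w \<longleftrightarrow> adjacent H (h v) (h w)" by auto
  show "v = w" if "h v = h w" using * that by simp
  show "adjacent H (h v) (h w)" if "adjacent G v w" using * that by simp
  show "adjacent G v w" if "adjacent H (h v) (h w)" using * that by simp
qed

text \<open>If the traces differ, they differ at a single \<open>w\<close>, and playing this
  \<open>w\<close> exposes it. So one round pays for the whole of \<open>W\<close>.\<close>

lemma ef_1_trace_W:
  assumes "ef G H 1 (insert (a, b) (fun_graph f X))" "a \<in> fset (verts G)" "b \<in> fset (verts H)"
  shows "trace G id W a = trace H h W b" "a \<in> W \<longleftrightarrow> b \<in> h ` W"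
proof -
  have "adjacent G a w \<longleftrightarrow> adjacent H b (h w)" if w: "w \<in> W" for w
  proof -
    have "ef G H (1 - 1) (insert (w, h w) (insert (a, b) (fun_graph f X)))"
      by (rule play_W[OF assms(1) _ _ w]) auto
    then have "partial_iso G H (insert (w, h w) (insert (a, b) (fun_graph f X)))"
      by (rule ef_partial_iso)
    then show ?thesis
      by (rule partial_isoD(2)) auto
  qed
  then show "trace G id W a = trace H h W b"
    by (auto simp: trace_def)
  show "a \<in> W \<longleftrightarrow> b \<in> h ` W"
    using reply_W[OF ef_partial_iso[OF assms(1)] assms(2,3)] by blast
qed

lemma trace_X_W: "trace G id X a = trace G id W a \<inter> X" "trace H f X b = trace H h W b \<inter> X"
  by (auto intro!: trace_Int simp: W_def h_X)

text \<open>Traces over \<open>W\<close> refine the classes over \<open>X\<close>, so the counting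
  takes place inside the class of \<open>\<tau> \<inter> X\<close>. One round is reserved for
  \<open>ef_1_trace_W\<close>, which leaves \<open>q - 1\<close>.\<close>

lemma card_trace_W:
  "card {a \<in> fset (verts G) - W. trace G id W a = \<tau>} =
   card {b \<in> fset (verts H) - h ` W. trace H h W b = \<tau>}"
proof -
  define t where "t = \<tau> \<inter> X"
  have hW: "h ` W = f ` X \<union> h ` Y" by (simp add: W_def image_Un h_X)
  have A': "{a \<in> fset (verts G) - W. trace G id W a = \<sigma>} =
      {a \<in> A - Y. trace G id W a = \<sigma>}" for \<sigma>
    by (auto simp: A_def W_def)
  have B': "{b \<in> fset (verts H) - h ` W. trace H h W b = \<sigma>} =
      {b \<in> B - h ` Y. trace H h W b = \<sigma>}" for \<sigma>
    unfolding hW by (auto simp: B_def)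
  have restr: "{a \<in> A - Y. trace G id W a = \<sigma>} = {a \<in> cl (\<sigma> \<inter> X) - Y. trace G id W a = \<sigma>}"
    "{b \<in> B - h ` Y. trace H h W b = \<sigma>} = {b \<in> cl' (\<sigma> \<inter> X) - h ` Y. trace H h W b = \<sigma>}" for \<sigma>
    by (auto simp: cl_def cl'_def trace_X_W)
  \<comment> \<open>Traces that do not restrict to \<open>t\<close> never occur in the class of
    \<open>t\<close>, so the comparison there is trivial.\<close>
  have empty: "{a \<in> cl t - Y. trace G id W a = \<sigma>} = {}"
    "{b \<in> cl' t - h ` Y. trace H h W b = \<sigma>} = {}" if "\<sigma> \<inter> X \<noteq> t" for \<sigma>
    using that by (auto simp: cl_def cl'_def trace_X_W)
  have le: "min (q - 1) (card {a \<in> A - Y. trace G id W a = \<sigma>}) \<le>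
      card {b \<in> B - h ` Y. trace H h W b = \<sigma>}" for \<sigma>
    unfolding A'[symmetric] B'[symmetric]
  proof (rule ef_card_le)
    show "ef G H (q - 1 + 1) (fun_graph f X)" using ef q_ge_2 by simp
  qed (use ef_1_trace_W in auto)
  have ge: "min (q - 1) (card {b \<in> B - h ` Y. trace H h W b = \<sigma>}) \<le>
      card {a \<in> A - Y. trace G id W a = \<sigma>}" for \<sigma>
    unfolding A'[symmetric] B'[symmetric]
  proof (rule ef_card_ge)
    show "ef G H (q - 1 + 1) (fun_graph f X)" using ef q_ge_2 by simp
  qed (use ef_1_trace_W in auto)
  have "card {a \<in> cl t - Y. trace G id W a = \<tau>} = card {b \<in> cl' t - h ` Y. trace H h W b = \<tau>}"
  proof (rule fibre_cards_agree)
    show "1 \<le> q - 1" using q_ge_2 by simp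
    \<comment> \<open>A class is either contained in \<open>Y\<close> or disjoint from it, and by
      \<open>card_cl\<close> the same alternative holds in \<open>H\<close>.\<close>
    show "card (cl t - Y) = card (cl' t - h ` Y)"
    proof (cases "card (cl t) = 1")
      case True
      then have "cl t - Y = {}" by (auto simp: cl_def Y_def)
      moreover have "cl' t - h ` Y = {}"
        using True card_cl[of t] by (auto simp: cl'_def h_Y)
      ultimately show ?thesis by (simp only: card.empty)
    next
      case False
      then have "cl t - Y = cl t" by (auto simp: cl_def Y_def)
      moreover have "cl' t - h ` Y = cl' t"
        using False card_cl[of t] by (auto simp: cl'_def h_Y)
      ultimately show ?thesis using card_cl by simp
    qed
    \<comment> \<open>The class and one vertex from each other class fit into \<open>A\<close>.
      Together with the summand 3 in \<open>rounds\<close>, this gives exactly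
      \<open>2 * q - 2\<close>.\<close>
    have "card (cl t) \<le> 2 * (q - 1)"
    proof (cases "t \<in> trace G id X ` A")
      case True
      have "card (cl t) + card (trace G id X ` A) \<le> card A + 1"
        unfolding cl_def by (rule card_fibre_bound) (use True in auto)
      then show ?thesis using rounds by (simp add: A_def)
    next
      case False
      then have "cl t = {}" by (auto simp: cl_def)
      then show ?thesis by simp
    qed
    then show "card (cl t - Y) \<le> 2 * (q - 1) \<or>
        card (cl t - Y) + 2 \<le> 2 * (q - 1) + card (trace G id W ` (cl t - Y))"
      using card_mono[of "cl t" "cl t - Y"] by simp
  next
    fix \<sigma>
    show "min (q - 1) (card {a \<in> cl t - Y. trace G id W a = \<sigma>})
        \<le> card {b \<in> cl' t - h ` Y. trace H h W b = \<sigma>}"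
    proof (cases "\<sigma> \<inter> X = t")
      case True
      then show ?thesis using le[of \<sigma>] by (simp only: restr)
    next
      case False
      show ?thesis unfolding empty[OF False] by simp
    qed
    show "min (q - 1) (card {b \<in> cl' t - h ` Y. trace H h W b = \<sigma>})
        \<le> card {a \<in> cl t - Y. trace G id W a = \<sigma>}"
    proof (cases "\<sigma> \<inter> X = t")
      case True
      then show ?thesis using ge[of \<sigma>] by (simp only: restr)
    next
      case False
      show ?thesis unfolding empty[OF False] by simp
    qed
  qed simp_all
  then show ?thesis
    unfolding A' B' restr t_def .
qed

text \<open>Vertices outside \<open>Y\<close> have a twin in their class, so homogeneity allows one
  endpoint to be moved within its class at a time: from \<open>(a, c)\<close> to
  \<open>(a, c')\<close> to \<open>(a', c')\<close>. If \<open>a = c'\<close>, the middle pair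
  degenerates, but then \<open>a'\<close> lies in the class of \<open>c\<close> and \<open>c\<close>
  can be moved to \<open>a'\<close> directly.\<close>

lemma adjacent_class_pair:
  assumes ac: "a \<in> A - Y" "c \<in> A - Y" "a \<noteq> c" and a'c': "a' \<in> A" "c' \<in> A" "a' \<noteq> c'"
    and tr: "trace G id X a' = trace G id X a" "trace G id X c' = trace G id X c"
  shows "adjacent G a c \<longleftrightarrow> adjacent G a' c'"
proof -
  have hom: "adjacent G u v \<longleftrightarrow> adjacent G u w"
    if u: "u \<in> A" "card (cl (trace G id X u)) \<noteq> 1" and "v \<in> A" "w \<in> A" "u \<noteq> v" "u \<noteq> w"
      "trace G id X v = trace G id X w" for u v w
  proof -
    have "cl (trace G id X u) \<noteq> {u}" using u by auto
    moreover have "u \<in> cl (trace G id X u)" using u by (simp add: cl_def)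
    ultimately obtain u' where "u' \<in> cl (trace G id X u)" "u \<noteq> u'" by blast
    then have "u' \<in> A" "u \<noteq> u'" "trace G id X u = trace G id X u'"
      unfolding cl_def by blast+
    then show ?thesis
      using homogeneous[of u u' v w] that unfolding A_def by blast
  qed
  have mem: "a \<in> A" "c \<in> A" using ac by simp_all
  have big: "card (cl (trace G id X a)) \<noteq> 1" "card (cl (trace G id X c)) \<noteq> 1"
    using ac by (auto simp: Y_def)
  show ?thesis
  proof (cases "a = c'")
    case False
    have "adjacent G a c \<longleftrightarrow> adjacent G a c'"
      by (rule hom[OF mem(1) big(1) mem(2) a'c'(2) ac(3) False tr(2)[symmetric]])
    also have "\<dots> \<longleftrightarrow> adjacent G c' a"
      by (rule adjacent_sym)
    also have "\<dots> \<longleftrightarrow> adjacent G c' a'"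
      using hom[OF a'c'(2) _ mem(1) a'c'(1) False[symmetric] a'c'(3)[symmetric] tr(1)[symmetric]]
        big(2) tr(2) by argo
    also have "\<dots> \<longleftrightarrow> adjacent G a' c'"
      by (rule adjacent_sym)
    finally show ?thesis .
  next
    case True
    then have eq: "a \<noteq> a'" "trace G id X c = trace G id X a'"
      using a'c'(3) tr by metis+
    have "adjacent G a c \<longleftrightarrow> adjacent G a a'"
      by (rule hom[OF mem(1) big(1) mem(2) a'c'(1) ac(3) eq])
    also have "\<dots> \<longleftrightarrow> adjacent G a' a"
      by (rule adjacent_sym)
    finally show ?thesis using True by simp
  qed
qed

theorem isomorphic: "isomorphic G H"
proof (rule isomorphicI_traces)
  show "simple_graph G" "simple_graph H" by (rule simple)+
  show "W \<subseteq> fset (verts G)" "h ` W \<subseteq> fset (verts H)" "partial_iso G H (fun_graph h W)"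
    by (rule W_subset h_W_subset partial_iso_W)+
  show "card {a \<in> fset (verts G) - W. trace G id W a = t} =
      card {b \<in> fset (verts H) - h ` W. trace H h W b = t}" for t
    by (rule card_trace_W)
  fix a c b d
  assume ac: "a \<in> fset (verts G) - W" "c \<in> fset (verts G) - W" "a \<noteq> c"
    and bd: "b \<in> fset (verts H) - h ` W" "d \<in> fset (verts H) - h ` W" "b \<noteq> d"
    and tr: "trace G id W a = trace H h W b" "trace G id W c = trace H h W d"
  \<comment> \<open>Two rounds in \<open>H\<close> on \<open>b\<close> and \<open>d\<close> yield a
    pair \<open>a'\<close>, \<open>c'\<close> with the right adjacency and the right traces over
    \<open>X\<close>; it need not be \<open>a\<close>, \<open>c\<close>, but it lies in the same
    classes.\<close>
  obtain a' where a': "a' \<in> fset (verts G)" "ef G H (q - 1) (insert (a', b) (fun_graph f X))"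
    by (rule ef_back[OF ef, of b]) (use q_ge_2 bd in auto)
  obtain c' where c': "c' \<in> fset (verts G)"
      "ef G H (q - 1 - 1) (insert (c', d) (insert (a', b) (fun_graph f X)))"
    by (rule ef_back[OF a'(2), of d]) (use q_ge_2 bd in auto)
  note pi = ef_partial_iso[OF c'(2)]
  have "a' \<noteq> c'" "adjacent G a' c' \<longleftrightarrow> adjacent H b d"
    using partial_isoD[OF pi, of a' b c' d] bd by auto
  moreover have "adjacent G a c \<longleftrightarrow> adjacent G a' c'"
  proof (rule adjacent_class_pair)
    have pa: "partial_iso G H (insert (a', b) (fun_graph f X))"
      and pc: "partial_iso G H (insert (c', d) (fun_graph f X))"
      by (rule partial_iso_mono[OF pi]; blast)+
    have fX: "f ` X \<subseteq> h ` W" by (auto simp: W_def image_Un h_X)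
    show "a' \<in> A" "c' \<in> A"
      using partial_iso_trace(2)[OF pa] partial_iso_trace(2)[OF pc] a' c' bd fX
      by (auto simp: A_def)
    show "trace G id X a' = trace G id X a" "trace G id X c' = trace G id X c"
      using partial_iso_trace(1)[OF pa] partial_iso_trace(1)[OF pc] tr by (simp_all add: trace_X_W)
    show "a \<in> A - Y" "c \<in> A - Y" using ac by (auto simp: A_def W_def)
  qed (use ac \<open>a' \<noteq> c'\<close> in auto)
  ultimately show "adjacent G a c \<longleftrightarrow> adjacent H b d" by simp
qed

end

lemma obtain_maximal_trace_set:
  fixes G :: "'a ugraph"
  defines "V \<equiv> fset (verts G)"
  assumes "verts G \<noteq> {||}"
  obtains X where "X \<subseteq> V" "card X + 1 \<le> card (trace G id X ` (V - X))"
    "\<And>u. u \<in> V - X \<Longrightarrow>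
       card (trace G id (insert u X) ` (V - insert u X)) \<le> card X + 1"
proof -
  define ok where "ok X \<longleftrightarrow> X \<subseteq> V \<and> card X + 1 \<le> card (trace G id X ` (V - X))" for X
  have finV: "finite V" by (simp add: V_def)
  have "V \<noteq> {}" using assms(2) by (auto simp: V_def)
  \<comment> \<open>Over the empty set there is a single class, so the maximum is taken over a
    nonempty family.\<close>
  then have "trace G id {} ` V = {{}}" by (auto simp: trace_def)
  then have "ok {}" by (simp add: ok_def)
  moreover have "card X < Suc (card V)" if "ok X" for X
    using that card_mono[OF finV] by (auto simp: ok_def less_Suc_eq_le)
  ultimately obtain X where X: "ok X" "\<And>X'. ok X' \<Longrightarrow> card X' \<le> card X"
    using ex_has_greatest_nat[of ok "{}" card "Suc (card V)"] by (meson less_imp_le)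
  have finX: "finite X" using X(1) finV finite_subset by (auto simp: ok_def)
  show ?thesis
  proof (rule that)
    show "X \<subseteq> V" "card X + 1 \<le> card (trace G id X ` (V - X))"
      using X(1) by (auto simp: ok_def)
    fix u assume u: "u \<in> V - X"
    show "card (trace G id (insert u X) ` (V - insert u X)) \<le> card X + 1"
    proof (rule ccontr)
      assume "\<not> ?thesis"
      \<comment> \<open>The enlarged set has \<open>card X + 1\<close> elements and would have at
        least \<open>card X + 2\<close> classes.\<close>
      then have "ok (insert u X)"
        using u X(1) finX by (auto simp: ok_def)
      then show False using X(2) u finX by force
    qed
  qed
qed

text \<open>Moving \<open>u\<close> into \<open>X\<close> loses no class, since its twin
  \<open>v\<close> stays outside. If \<open>u\<close> also separated \<open>c\<close> from
  \<open>d\<close>, the number of classes would grow, against the maximality in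
  \<open>max\<close>.\<close>

lemma maximal_trace_set_homogeneous:
  fixes G :: "'a ugraph"
  defines "V \<equiv> fset (verts G)"
  assumes card: "card X + 1 \<le> card (trace G id X ` (V - X))"
    and max: "card (trace G id (insert u X) ` (V - insert u X)) \<le> card X + 1"
    and uv: "u \<in> V - X" "v \<in> V - X" "u \<noteq> v" "trace G id X u = trace G id X v"
    and cd: "c \<in> V - X" "d \<in> V - X" "u \<noteq> c" "u \<noteq> d" "trace G id X c = trace G id X d"
  shows "adjacent G u c \<longleftrightarrow> adjacent G u d"
proof (rule ccontr)
  assume ne: "\<not> ?thesis"
  let ?T = "trace G id (insert u X) ` (V - insert u X)"
  have restr: "trace G id (insert u X) a \<inter> X = trace G id X a" for a
    by (auto simp: trace_def)
  have "trace G id X ` (V - X) \<subseteq> (\<lambda>t. t \<inter> X) ` ?T"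
  proof
    fix t assume "t \<in> trace G id X ` (V - X)"
    then obtain a where a: "a \<in> V - X" "t = trace G id X a" by blast
    define b where "b = (if a = u then v else a)"
    have "b \<in> V - insert u X" "t = trace G id X b"
      using a uv by (simp_all add: b_def)
    then have "t \<in> trace G id X ` (V - insert u X)" by blast
    then show "t \<in> (\<lambda>t. t \<inter> X) ` ?T" by (simp add: image_image restr)
  qed
  moreover have finT: "finite ?T" by (simp add: V_def)
  ultimately have "card (trace G id X ` (V - X)) \<le> card ((\<lambda>t. t \<inter> X) ` ?T)"
    by (intro card_mono) auto
  \<comment> \<open>Restriction to \<open>X\<close> merges the traces of \<open>c\<close> and
    \<open>d\<close>, which differ at \<open>u\<close>, so it is not injective.\<close>
  moreover have "card ((\<lambda>t. t \<inter> X) ` ?T) < card ?T"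
  proof (rule ccontr)
    assume "\<not> ?thesis"
    then have "card ((\<lambda>t. t \<inter> X) ` ?T) = card ?T"
      using card_image_le[OF finT, of "\<lambda>t. t \<inter> X"] by simp
    then have "inj_on (\<lambda>t. t \<inter> X) ?T"
      using finT by (intro eq_card_imp_inj_on)
    moreover have "trace G id (insert u X) c \<inter> X = trace G id (insert u X) d \<inter> X"
      using cd(5) by (simp only: restr)
    moreover have "trace G id (insert u X) c \<in> ?T" "trace G id (insert u X) d \<in> ?T"
      using cd by blast+
    ultimately have "trace G id (insert u X) c = trace G id (insert u X) d"
      by (rule inj_onD)
    moreover have "u \<in> trace G id (insert u X) a \<longleftrightarrow> adjacent G a u" for a
      by (simp add: trace_def)
    ultimately have "adjacent G c u \<longleftrightarrow> adjacent G d u"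
      by metis
    then show False using ne adjacent_sym by metis
  qed
  ultimately show False using card max by linarith
qed

theorem ef_isomorphic:
  assumes simple: "simple_graph G" "simple_graph H"
    and order: "order G = order H" "order G \<ge> 1"
    and ef: "ef G H K {}" and K: "order G + 2 \<le> 2 * K"
  shows "isomorphic G H"
proof -
  let ?V = "fset (verts G)"
  have ne: "verts G \<noteq> {||}" using order(2) by (auto simp: order_def fcard.rep_eq)
  obtain X where X: "X \<subseteq> ?V" "card X + 1 \<le> card (trace G id X ` (?V - X))"
    "\<And>u. u \<in> ?V - X \<Longrightarrow> card (trace G id (insert u X) ` (?V - insert u X)) \<le> card X + 1"
    using obtain_maximal_trace_set[OF ne] by blast
  have finX: "finite X" by (rule finite_subset[OF X(1)]) simp
  have cardV: "card ?V = order G" by (simp add: order_def fcard.rep_eq)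
  have card_diff: "card (?V - X) + card X = order G"
    using X(1) finX card_mono[OF _ X(1)] cardV by (simp add: card_Diff_subset)
  have "card X + 1 \<le> card (?V - X)"
    using X(2) card_image_le[of "?V - X" "trace G id X"] by simp
  then have le: "card X \<le> K" using card_diff K by simp
  then have "ef G H (card X + (K - card X)) {}" using ef by simp
  then obtain f where f: "f ` X \<subseteq> fset (verts H)" "ef G H (K - card X) ({} \<union> fun_graph f X)"
    using ef_play_set[OF finX X(1), of H] by blast
  interpret ef_position G H X f "K - card X"
  proof
    \<comment> \<open>Substitute \<open>order G = card (?V - X) + card X\<close> into
      \<open>K\<close> and use that there are at least \<open>card X + 1\<close> classes.\<close>
    show "card (?V - X) + 3 \<le> 2 * (K - card X) + card (trace G id X ` (?V - X))"
      using card_diff K X(2) le by simp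
  next
    fix u v c d
    assume *: "u \<in> ?V - X" "v \<in> ?V - X" "u \<noteq> v" "trace G id X u = trace G id X v"
      "c \<in> ?V - X" "d \<in> ?V - X" "u \<noteq> c" "u \<noteq> d" "trace G id X c = trace G id X d"
    show "adjacent G u c \<longleftrightarrow> adjacent G u d"
      by (rule maximal_trace_set_homogeneous[OF X(2) X(3)]) (use * in auto)
  qed (use simple order X f in auto)
  show ?thesis by (rule isomorphic)
qed

section \<open>From stable colorings to the game\<close>

lemma ef_0_insert:
  assumes "partial_iso G H P" "adjacent G w w \<longleftrightarrow> adjacent H w' w'"
    and "\<And>a b. (a, b) \<in> P \<Longrightarrow> (w = a \<longleftrightarrow> w' = b) \<and> (adjacent G w a \<longleftrightarrow> adjacent H w' b)"
  shows "ef G H 0 (insert (w, w') P)"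
proof -
  have "(a = c \<longleftrightarrow> b = d) \<and> (adjacent G a c \<longleftrightarrow> adjacent H b d)"
    if "(a, b) \<in> insert (w, w') P" "(c, d) \<in> insert (w, w') P" for a b c d
    using that assms(2) assms(3)[of a b] assms(3)[of c d] partial_isoD[OF assms(1), of a b c d]
      adjacent_sym[of G a c] adjacent_sym[of H b d]
    by auto
  then show ?thesis by (simp add: partial_iso_def)
qed

text \<open>The first \<open>k - j\<close> coordinates carry the played pairs and the other
  \<open>j\<close> are free to be overwritten, one per round. One further round is survived when no
  coordinate is free, which is why \<open>Suc j\<close> rounds are claimed.\<close>

lemma stable_tuples_ef:
  assumes "k \<ge> 2"
    and len: "\<And>u v. R u v \<Longrightarrow> length u = k \<and> length v = k"
    and iso: "\<And>u v. R u v \<Longrightarrow> iso_type k G u = iso_type k H v"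
    and forth: "\<And>u v w. R u v \<Longrightarrow> w \<in> fset (verts G) \<Longrightarrow>
        \<exists>w' \<in> fset (verts H). \<forall>i<k. R (u[i := w]) (v[i := w'])"
    and backw: "\<And>u v w'. R u v \<Longrightarrow> w' \<in> fset (verts H) \<Longrightarrow>
        \<exists>w \<in> fset (verts G). \<forall>i<k. R (u[i := w]) (v[i := w'])"
  shows "R u v \<Longrightarrow> j < k \<Longrightarrow> ef G H (Suc j) {(u ! i, v ! i) | i. i < k - j}"
proof (induction j arbitrary: u v)
  have eq: "(u ! i = u ! j \<longleftrightarrow> v ! i = v ! j) \<and> (adjacent G (u ! i) (u ! j) \<longleftrightarrow> adjacent H (v ! i) (v ! j))"
    if "R u v" "i < k" "j < k" for u v i j
    using iso[OF that(1)] that(2,3) unfolding iso_type_eq_iff by blast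
  {
    case 0
    let ?P = "{(u ! i, v ! i) | i. i < k - 0}"
    have P: "partial_iso G H ?P"
      using eq[OF 0(1)] unfolding partial_iso_def by auto
    have step: "ef G H 0 (insert (w, w') ?P)" if w: "\<forall>i<k. R (u[i := w]) (v[i := w'])" for w w'
    proof -
      have new: "(w = u ! i \<longleftrightarrow> w' = v ! i) \<and> (adjacent G w (u ! i) \<longleftrightarrow> adjacent H w' (v ! i))"
        if "i < k" for i
      proof -
        \<comment> \<open>To compare \<open>w\<close> with the \<open>i\<close>-th pair, overwrite a
          different coordinate \<open>l\<close>; this needs \<open>k \<ge> 2\<close>. The same reply
          \<open>w'\<close> works for every \<open>l\<close>, so all coordinates are checked
          although none is free.\<close>
        have "\<exists>l<k. l \<noteq> i"
          using \<open>k \<ge> 2\<close> by (intro exI[of _ "if i = 0 then 1 else 0"]) auto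
        then obtain l where l: "l < k" "l \<noteq> i" by blast
        then show ?thesis
          using eq[of "u[l := w]" "v[l := w']" l i] w that len[OF 0(1)] by simp
      qed
      moreover have "adjacent G w w \<longleftrightarrow> adjacent H w' w'"
        using eq[of "u[0 := w]" "v[0 := w']" 0 0] w \<open>k \<ge> 2\<close> len[OF 0(1)] by simp
      ultimately show ?thesis
        using P by (intro ef_0_insert) auto
    qed
    show ?case
      unfolding ef.simps(2)[of G H 0]
      using P step forth[OF 0(1)] backw[OF 0(1)] by meson
  next
    case (Suc j)
    let ?P = "{(u ! i, v ! i) | i. i < k - Suc j}"
    \<comment> \<open>The first free coordinate; it receives the new pair.\<close>
    define l where "l = k - Suc j"
    have l: "l < k" "k - j = Suc l" using Suc.prems(2) by (auto simp: l_def)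
    have step: "ef G H (Suc j) (insert (w, w') ?P)" if w: "\<forall>i<k. R (u[i := w]) (v[i := w'])" for w w'
    proof -
      have "ef G H (Suc j) {(u[l := w] ! i, v[l := w'] ! i) | i. i < k - j}"
        using Suc.IH[of "u[l := w]" "v[l := w']"] w l Suc.prems(2) by simp
      moreover have "insert (w, w') ?P \<subseteq> {(u[l := w] ! i, v[l := w'] ! i) | i. i < k - j}"
      proof -
        have "(w, w') \<in> {(u[l := w] ! i, v[l := w'] ! i) | i. i < k - j}"
          using l len[OF Suc.prems(1)] by (auto intro!: exI[of _ l])
        moreover have "?P \<subseteq> {(u[l := w] ! i, v[l := w'] ! i) | i. i < k - j}"
        proof
          fix p assume "p \<in> ?P"
          then obtain i where "i < l" "p = (u ! i, v ! i)" by (auto simp: l_def)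
          then show "p \<in> {(u[l := w] ! i, v[l := w'] ! i) | i. i < k - j}"
            using l by (auto intro!: exI[of _ i])
        qed
        ultimately show ?thesis by blast
      qed
      ultimately show ?thesis by (rule ef_mono)
    qed
    have "partial_iso G H ?P"
      using eq[OF Suc.prems(1)] unfolding partial_iso_def by auto
    then show ?case
      unfolding ef.simps(2)[of G H "Suc j"]
      using step forth[OF Suc.prems(1)] backw[OF Suc.prems(1)] by meson
  }
qed

section \<open>Refinement and its stopping round\<close>

lemma wl_color_Suc_eqD: "wl_color k G (Suc r) u = wl_color k H (Suc r) v \<Longrightarrow>
    wl_color k G r u = wl_color k H r v"
  by simp

lemma wl_color_eq_iso_type:
  "wl_color k G r u = wl_color k H r v \<Longrightarrow> iso_type k G u = iso_type k H v"
  by (induction r) auto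

text \<open>A refined color keeps, for each \<open>w\<close>, all \<open>k\<close> substituted
  colors in one list. Equal lists therefore give a single reply \<open>w'\<close> valid at all
  positions at once.\<close>

lemma wl_color_Suc_forth:
  assumes "wl_color k G (Suc r) u = wl_color k H (Suc r) v" "w \<in> fset (verts G)"
  shows "\<exists>w' \<in> fset (verts H). \<forall>i<k. wl_color k G r (u[i := w]) = wl_color k H r (v[i := w'])"
proof -
  let ?c = "\<lambda>w. map (\<lambda>i. wl_color k G r (u[i := w])) [0..<k]"
  let ?d = "\<lambda>w. map (\<lambda>i. wl_color k H r (v[i := w])) [0..<k]"
  have "?c |`| verts G = ?d |`| verts H"
    using assms(1) by simp
  from arg_cong[OF this, of fset] have "?c ` fset (verts G) = ?d ` fset (verts H)"
    by (simp only: fimage.rep_eq)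
  moreover have "?c w \<in> ?c ` fset (verts G)" using assms(2) by (rule imageI)
  ultimately obtain w' where w': "w' \<in> fset (verts H)" "?c w = ?d w'"
    by (metis (no_types, lifting) imageE)
  then have "\<forall>i<k. wl_color k G r (u[i := w]) = wl_color k H r (v[i := w'])"
    by (auto simp: list_eq_iff_nth_eq)
  then show ?thesis using w'(1) by blast
qed

lemma finite_tuples: "finite (tuples k G)"
  using finite_lists_length_eq[of "fset (verts G)" k] by (simp add: tuples_def conj_commute)

lemma wl_rel_finite: "finite (wl_rel k G H r)"
proof (rule finite_subset)
  show "wl_rel k G H r \<subseteq> (tuples k G \<union> tuples k H) \<times> (tuples k G \<union> tuples k H)"
    by (auto simp: wl_rel_def)
qed (simp add: finite_tuples)

lemma wl_rel_Suc_subset: "wl_rel k G H (Suc r) \<subseteq> wl_rel k G H r"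
  unfolding wl_rel_def by (auto dest: wl_color_Suc_eqD)

text \<open>Otherwise the finite relations would shrink strictly forever. This supplies the witness
  without which the \<open>LEAST\<close> in \<open>wl_stop\<close> would say nothing.\<close>

lemma wl_rel_stabilizes: "\<exists>r\<ge>1. wl_rel k G H r = wl_rel k G H (r - 1)"
proof (rule ccontr)
  assume "\<not> ?thesis"
  then have "wl_rel k G H (Suc r) \<subset> wl_rel k G H r" for r
    using wl_rel_Suc_subset[of k G H r] by (metis diff_Suc_1 le_add1 plus_1_eq_Suc psubsetI)
  then have dec: "card (wl_rel k G H (Suc r)) < card (wl_rel k G H r)" for r
    by (intro psubset_card_mono wl_rel_finite)
  have "card (wl_rel k G H r) + r \<le> card (wl_rel k G H 0)" for r
  proof (induction r)
    case (Suc r)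
    then show ?case using dec[of r] by simp
  qed simp
  from this[of "Suc (card (wl_rel k G H 0))"] show False by simp
qed

lemma tuples_disjoint:
  assumes "k \<ge> 1" "fset (verts G) \<inter> fset (verts H) = {}" "u \<in> tuples k G" "u \<in> tuples k H"
  shows False
proof -
  have "u \<noteq> []" using assms(1,3) by (auto simp: tuples_def)
  then have "hd u \<in> fset (verts G) \<inter> fset (verts H)"
    using assms(3,4) by (auto simp: tuples_def)
  then show False using assms(2) by blast
qed

text \<open>Disjointness gives transitivity: the middle tuple belongs to only one of the graphs, so
  its color is unambiguous.\<close>

lemma wl_rel_equiv:
  assumes "k \<ge> 1" "fset (verts G) \<inter> fset (verts H) = {}"
  shows "equiv (tuples k G \<union> tuples k H) (wl_rel k G H r)"
proof -
  note disj = tuples_disjoint[OF assms]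
  show ?thesis
  proof (rule equivI)
    show "wl_rel k G H r \<subseteq> (tuples k G \<union> tuples k H) \<times> (tuples k G \<union> tuples k H)"
      by (auto simp: wl_rel_def)
    show "refl_on (tuples k G \<union> tuples k H) (wl_rel k G H r)"
      by (auto simp: refl_on_def wl_rel_def)
    show "sym (wl_rel k G H r)"
      by (rule symI) (auto simp: wl_rel_def)
    show "trans (wl_rel k G H r)"
      by (rule transI) (auto simp: wl_rel_def dest: disj)
  qed
qed

text \<open>The stopping rule compares partitions, whereas the game needs colors; this translates
  back to the relations.\<close>

lemma quotient_eq_imp_subset:
  assumes "equiv S r" "equiv S s" "S // r = S // s"
  shows "r \<subseteq> s"
proof
  fix p assume p: "p \<in> r"
  obtain x y where xy: "p = (x, y)" by (cases p)
  have x: "x \<in> S" using assms(1) p xy by (meson equiv_class_eq_iff)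
  then have "r `` {x} \<in> S // s" using assms(3) quotientI by metis
  then obtain z where "r `` {x} = s `` {z}" by (auto elim: quotientE)
  moreover have "x \<in> r `` {x}" "y \<in> r `` {x}"
    using p xy equiv_class_self[OF assms(1) x] by auto
  ultimately have "(z, x) \<in> s" "(z, y) \<in> s" by auto
  then show "p \<in> s"
    using assms(2) xy by (meson equivE symE transE)
qed

lemma wl_stop_stable:
  assumes k: "k \<ge> 1" "fset (verts G) \<inter> fset (verts H) = {}"
  obtains r where "wl_stop k G H = Suc r"
    "\<And>u v. u \<in> tuples k G \<Longrightarrow> v \<in> tuples k H \<Longrightarrow> wl_color k G r u = wl_color k H r v \<Longrightarrow>
       wl_color k G (Suc r) u = wl_color k H (Suc r) v"
proof -
  define s where "s = wl_stop k G H"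
  have "\<exists>r\<ge>1. wl_partition k G H r = wl_partition k G H (r - 1)"
    using wl_rel_stabilizes[of k G H] unfolding wl_partition_def by metis
  then have s: "s \<ge> 1 \<and> wl_partition k G H s = wl_partition k G H (s - 1)"
    unfolding s_def wl_stop_def by (rule LeastI_ex)
  then obtain r where r: "s = Suc r" by (cases s) auto
  have sub: "wl_rel k G H r \<subseteq> wl_rel k G H (Suc r)"
    using s r by (intro quotient_eq_imp_subset[OF wl_rel_equiv[OF k] wl_rel_equiv[OF k]])
      (simp add: wl_partition_def)
  show ?thesis
  proof (rule that)
    show "wl_stop k G H = Suc r" using r s_def by simp
    fix u v assume uv: "u \<in> tuples k G" "v \<in> tuples k H" "wl_color k G r u = wl_color k H r v"
    then have "(u, v) \<in> wl_rel k G H r" by (auto simp: wl_rel_def)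
    then obtain G1 H1 where GH: "G1 \<in> {G, H}" "H1 \<in> {G, H}" "u \<in> tuples k G1" "v \<in> tuples k H1"
      "wl_color k G1 (Suc r) u = wl_color k H1 (Suc r) v"
      using sub unfolding wl_rel_def by blast
    have "G1 = G" "H1 = H" using GH uv tuples_disjoint[OF k] by auto
    then show "wl_color k G (Suc r) u = wl_color k H (Suc r) v" using GH by simp
  qed
qed

text \<open>Equality of the diagonal color sets answers the first round. A diagonal tuple then
  carries a single pair, from which stability of the colors gives \<open>k\<close> more
  rounds.\<close>

lemma wl_decides_iso_ef:
  assumes k: "k \<ge> 2" and disj: "fset (verts G) \<inter> fset (verts H) = {}"
    and dec: "wl_decides_iso k G H"
  shows "ef G H (Suc k) {}"
proof -
  obtain r where r: "wl_stop k G H = Suc r"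
    and stable: "\<And>u v. u \<in> tuples k G \<Longrightarrow> v \<in> tuples k H \<Longrightarrow>
      wl_color k G r u = wl_color k H r v \<Longrightarrow> wl_color k G (Suc r) u = wl_color k H (Suc r) v"
    using wl_stop_stable[of k G H] k disj by auto
  \<comment> \<open>Colors of round \<open>r\<close>, one before the stopping round: equality there
    already implies equality one round later, so \<open>R\<close> is closed under suitable
    replies.\<close>
  define R where "R u v \<longleftrightarrow> u \<in> tuples k G \<and> v \<in> tuples k H \<and>
      wl_color k G r u = wl_color k H r v" for u v
  have upd: "u[i := w] \<in> tuples k F" if "u \<in> tuples k F" "w \<in> fset (verts F)"
    for u i w and F :: "'a ugraph"
    using that by (auto simp: tuples_def dest!: subsetD[OF set_update_subset_insert])
  have game: "ef G H (Suc (k - 1)) {(u ! i, v ! i) | i. i < k - (k - 1)}" if "R u v" for u v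
  proof (rule stable_tuples_ef[where R = R])
    fix u v assume uv: "R u v"
    show "length u = k \<and> length v = k" using uv by (auto simp: R_def tuples_def)
    show "iso_type k G u = iso_type k H v"
      using uv unfolding R_def by (blast intro: wl_color_eq_iso_type)
    have c: "wl_color k G (Suc r) u = wl_color k H (Suc r) v"
      using stable uv unfolding R_def by blast
    show "\<exists>w' \<in> fset (verts H). \<forall>i<k. R (u[i := w]) (v[i := w'])" if w: "w \<in> fset (verts G)" for w
    proof -
      obtain w' where "w' \<in> fset (verts H)"
        "\<forall>i<k. wl_color k G r (u[i := w]) = wl_color k H r (v[i := w'])"
        using wl_color_Suc_forth[OF c w] by blast
      then show ?thesis using uv w upd unfolding R_def by (intro bexI[of _ w']) simp_all
    qed
    show "\<exists>w \<in> fset (verts G). \<forall>i<k. R (u[i := w]) (v[i := w'])" if w': "w' \<in> fset (verts H)" for w'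
    proof -
      obtain w where "w \<in> fset (verts G)"
        "\<forall>i<k. wl_color k H r (v[i := w']) = wl_color k G r (u[i := w])"
        using wl_color_Suc_forth[OF c[symmetric] w'] by blast
      then show ?thesis using uv w' upd unfolding R_def by (intro bexI[of _ w]) simp_all
    qed
  qed (use k that in auto)
  have diag: "ef G H k {(u, v)}" if "u \<in> fset (verts G)" "v \<in> fset (verts H)"
    "wl_color k G (Suc r) (replicate k u) = wl_color k H (Suc r) (replicate k v)" for u v
  proof -
    have "R (replicate k u) (replicate k v)"
      using that(1,2) wl_color_Suc_eqD[OF that(3)] by (auto simp: R_def tuples_def)
    from game[OF this] have "ef G H k {(replicate k u ! i, replicate k v ! i) | i. i < 1}"
      using k by simp
    moreover have "{(replicate k u ! i, replicate k v ! i) | i. i < 1} = {(u, v)}"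
      using k by auto
    ultimately show ?thesis by simp
  qed
  have eq: "diagonal_colors k G (Suc r) = diagonal_colors k H (Suc r)"
    using dec r by (simp add: wl_decides_iso_def)
  have "\<exists>v \<in> fset (verts H). ef G H k {(u, v)}" if u: "u \<in> fset (verts G)" for u
  proof -
    have "wl_color k G (Suc r) (replicate k u) \<in> diagonal_colors k H (Suc r)"
      using u eq[symmetric] unfolding diagonal_colors_def by blast
    then obtain v where v: "v \<in> fset (verts H)"
      "wl_color k G (Suc r) (replicate k u) = wl_color k H (Suc r) (replicate k v)"
      unfolding diagonal_colors_def by blast
    show ?thesis using diag[OF u v] v(1) by blast
  qed
  moreover have "\<exists>u \<in> fset (verts G). ef G H k {(u, v)}" if v: "v \<in> fset (verts H)" for v
  proof -
    have "wl_color k H (Suc r) (replicate k v) \<in> diagonal_colors k G (Suc r)"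
      using v eq unfolding diagonal_colors_def by blast
    then obtain u where u: "u \<in> fset (verts G)"
      "wl_color k H (Suc r) (replicate k v) = wl_color k G (Suc r) (replicate k u)"
      unfolding diagonal_colors_def by blast
    show ?thesis using diag[OF u(1) v u(2)[symmetric]] u(1) by blast
  qed
  ultimately show ?thesis by (simp add: partial_iso_def)
qed

section \<open>Small orders and the final bound\<close>

lemma isomorphic_order_le_1:
  assumes "simple_graph G" "simple_graph H" "order G = order H" "order G \<le> 1"
  shows "isomorphic G H"
proof -
  have c: "card (fset (verts G)) = card (fset (verts H))" "card (fset (verts G)) \<le> 1"
    using assms(3,4) by (simp_all add: order_def fcard.rep_eq)
  then obtain f where f: "bij_betw f (fset (verts G)) (fset (verts H))"
    using finite_same_card_bij by (metis finite_fset)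
  have "u = v" if "u \<in> fset (verts G)" "v \<in> fset (verts G)" for u v
    using c(2) that by (auto simp: card_le_Suc0_iff_eq)
  then show ?thesis
    unfolding isomorphic_def using f assms(1,2) by (metis not_adjacent_self)
qed

theorem theorem7p6:
  fixes n :: nat
  assumes "n \<noteq> 2"
  shows "ereal_of_enat (wl_max n) \<le> ereal ((real n + 1) / 2)"
proof -
  define k where "k = (n + 1) div 2"
  have "wl_max n \<le> enat k"
    unfolding wl_max_def
  proof (rule Sup_least, safe)
    fix G H :: "nat ugraph"
    assume *: "simple_graph G" "simple_graph H" "fset (verts G) \<inter> fset (verts H) = {}"
      "order H = order G" "\<not> isomorphic G H" "n = order G"
    \<comment> \<open>For \<open>n \<le> 1\<close> there are no non-isomorphic pairs. As
      \<open>n\<close> is not 2 either, \<open>n \<ge> 3\<close> and the dimension \<open>k\<close>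
      is at least 2, as the game argument requires.\<close>
    have "n \<ge> 2" using isomorphic_order_le_1[of G H] * by force
    then have k: "k \<ge> 2" using assms by (simp add: k_def)
    have "\<not> wl_decides_iso k G H"
    proof
      assume "wl_decides_iso k G H"
      then have "ef G H (Suc k) {}" using wl_decides_iso_ef k * by blast
      \<comment> \<open>Rounding in \<open>k\<close> is harmless: \<open>2 * k \<ge> n\<close>,
        hence \<open>2 * Suc k \<ge> n + 2\<close>.\<close>
      then have "isomorphic G H"
        using * \<open>n \<ge> 2\<close> by (intro ef_isomorphic[of G H "Suc k"]) (auto simp: k_def)
      then show False using * by simp
    qed
    then have "wl_correct k G H" using * by (simp add: wl_correct_def)
    then show "wl_dim G H \<le> enat k"
      unfolding wl_dim_def using k by (intro Inf_lower) auto
  qed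
  then have "ereal_of_enat (wl_max n) \<le> ereal_of_enat (enat k)"
    by (simp only: ereal_of_enat_le_iff)
  also have "\<dots> \<le> ereal ((real n + 1) / 2)"
    by (simp add: k_def)
  finally show ?thesis .
qed

end
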